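(* For every integer $N\ge1$ and every integer $n\ge0$, the following identity holds (as rational functions in $x$): $$\sum_{l=0}^{n}\binom{N+n-l}{n-l}V_{l}^{(N+1)}(x)=\frac{1}{2^{N}N!}\sum_{i=1}^{N}\sum_{l=0}^{i}a_{i}(N)\frac{i!}{l!}\sum_{m+s+p=n}\binom{2N+m-i-1}{m}\binom{i-l+s}{s}(p+l)_{l}\,x^{i-2N-m}\,V_{p+l}(x),$$ where the innermost sum is over all integers $m,s,p\ge0$ with $m+s+p=n$.
   Context: The Chebyshev polynomials of the third kind $V_n(x)$ and the higher-order ones $V_n^{(\alpha)}(x)$ are defined by the formal power series in $t$ $$\frac{1-t}{1-2xt+t^{2}}=\sum_{n=0}^{\infty}V_{n}(x)t^{n},\qquad \left(\frac{1-t}{1-2xt+t^{2}}\right)^{\alpha}=\sum_{n=0}^{\infty}V_{n}^{(\alpha)}(x)t^{n}.$$ For a number $y$ and integer $n\ge1$, $(y)_{n}=y(y-1)\cdots(y-n+1)$ is the falling factorial, and $(y)_{0}=1$. The double factorial is $(2k-1)!!=(2k-1)(2k-3)\cdots 3\cdot 1$ for $k\ge1$, with $(-1)!!=1$. The numbers $a_i(N)$, $1\le i\le N$, are defined by $a_{1}(N)=(2N-3)!!$ and, for $2\le i\le N$, $$a_{i}(N)=\sum_{k_{i-1}=0}^{N-i}\ \sum_{k_{i-2}=0}^{N-i-k_{i-1}}\cdots\sum_{k_{1}=0}^{N-i-k_{i-1}-\cdots-k_{2}}2^{\sum_{j=1}^{i-1}k_{j}}\left[\prod_{j=2}^{i}\left(N-\sum_{l=j}^{i-1}k_{l}-\frac{2i+2-j}{2}\right)_{k_{j-1}}\right]\left(2\left(N-i-\sum_{j=1}^{i-1}k_{j}\right)-1\right)!!,$$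 where empty sums are $0$. *)

theory Defs
  imports "HOL-Computational_Algebra.Computational_Algebra"
begin

definition cheb3_gf :: "'a::field_char_0 \<Rightarrow> 'a fps" where
  "cheb3_gf x = (1 - fps_X) / (1 - fps_const (2 * x) * fps_X + fps_X ^ 2)"

definition cheb3 :: "nat \<Rightarrow> 'a::field_char_0 \<Rightarrow> 'a" where
  "cheb3 n x = fps_nth (cheb3_gf x) n"

(* The generating function F has constant term 1, so its power with arbitrary exponent alpha is
   the binomial series (1 + t)^alpha with F - 1 substituted for t. *)
definition cheb3_ho :: "'a::field_char_0 \<Rightarrow> nat \<Rightarrow> 'a \<Rightarrow> 'a" where
  "cheb3_ho \<alpha> n x = fps_nth (fps_compose (fps_binomial \<alpha>) (cheb3_gf x - 1)) n"

lemma cheb3_ho_of_nat: "cheb3_ho (of_nat k) n x = fps_nth (cheb3_gf x ^ k) n"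
proof -
  have "fps_nth (1 - fps_const (2 * x) * fps_X + fps_X ^ 2) 0 = 1"
    by simp
  then have "fps_nth (cheb3_gf x) 0 = 1"
    unfolding cheb3_gf_def by (subst fps_divide_unit) simp_all
  then have "fps_nth (cheb3_gf x - 1) 0 = 0"
    by simp
  then show ?thesis
    by (simp add: cheb3_ho_def fps_binomial_of_nat fps_compose_power [symmetric]
        fps_compose_add_distrib)
qed

definition falling_fact :: "'a::comm_ring_1 \<Rightarrow> nat \<Rightarrow> 'a" where
  "falling_fact y n = (\<Prod>i<n. y - of_nat i)"

(* odd_dfact k is (2k - 1)!!; in particular odd_dfact 0 is (-1)!! = 1. *)
definition odd_dfact :: "nat \<Rightarrow> nat" where
  "odd_dfact k = (\<Prod>j=1..k. 2 * j - 1)"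

(* nested_sum r M f k is the r-fold sum over k_r = 0..M, then k_{r-1} = 0..M - k_r, ..., and
   finally k_1 = 0..M - k_r - ... - k_2, of f evaluated at k updated with k_1, ..., k_r. *)
fun nested_sum :: "nat \<Rightarrow> nat \<Rightarrow> ((nat \<Rightarrow> nat) \<Rightarrow> 'a::comm_monoid_add) \<Rightarrow> (nat \<Rightarrow> nat) \<Rightarrow> 'a" where
  "nested_sum 0 M f k = f k"
| "nested_sum (Suc r) M f k = (\<Sum>v=0..M. nested_sum r (M - v) f (k(Suc r := v)))"

(* Meant for 1 <= i <= N. For i = 1 the value (2N - 3)!! is odd_dfact (N - 1). For i >= 2 the
   summand reads k only at 1, ..., i - 1, so the initial assignment does not matter; the natural
   number subtraction N - i - (...) never truncates on the summation range. The values are taken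
   in an arbitrary field of characteristic 0 because the falling factorials have half-integer
   arguments. *)
definition a_num :: "nat \<Rightarrow> nat \<Rightarrow> 'a::field_char_0" where
  "a_num i N =
     (if i = 1 then of_nat (odd_dfact (N - 1))
      else nested_sum (i - 1) (N - i)
        (\<lambda>k. 2 ^ (\<Sum>j=1..i-1. k j) *
             (\<Prod>j=2..i. falling_fact
                (of_nat N - of_nat (\<Sum>l=j..i-1. k l) - (2 * of_nat i + 2 - of_nat j) / 2)
                (k (j - 1))) *
             of_nat (odd_dfact (N - i - (\<Sum>j=1..i-1. k j))))
        (\<lambda>_. 0))"

(* The indeterminate x of the field R(x) of rational functions. *)
definition ratfun_x :: "real poly fract" where
  "ratfun_x = to_fract [:0, 1:]"

end

theory Submission
  imports Defs
begin

text \<open>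
  Put \<open>G = 1 / (1 - 2 x t + t\<^sup>2)\<close>, so that \<open>F = (1 - t) G\<close> generates the \<open>V\<^sub>n\<close>. The left-hand side is the
  coefficient of \<open>t\<^sup>n\<close> in \<open>G ^ (N + 1) = F ^ (N + 1) / (1 - t) ^ (N + 1)\<close>. Since
  \<open>G' = 2 (x - t) G\<^sup>2\<close>, repeated differentiation expresses \<open>2 ^ N N! G ^ (N + 1)\<close> as a combination
  of \<open>(x - t) powi (i - 2 N)\<close> times the \<open>i\<close>-th derivative of \<open>G\<close>, whose coefficients obey
  \<open>a (i, N + 1) = (2 N - i) a (i, N) + a (i - 1, N)\<close>; unrolling this recurrence in \<open>N\<close> gives the
  nested sums. Leibniz' rule for \<open>G = F / (1 - t)\<close> and comparison of coefficients then yield the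
  right-hand side.
\<close>

section \<open>Nested sums and the triangular recurrence for \<open>a_num\<close>\<close>

text \<open>Congruence and extraction of a constant factor in one induction. The two initial
  assignments may differ, since a variable that is already fixed on one side may have been absorbed
  into \<open>c\<close> or into \<open>g\<close> on the other.\<close>

lemma nested_sum_scale:
  fixes c :: "'a::comm_semiring_0"
  assumes "\<And>h h'. (\<And>j. j \<in> {1..r} \<Longrightarrow> h j = h' j) \<Longrightarrow>
      (\<And>j. j \<notin> {1..r} \<Longrightarrow> h j = k j) \<Longrightarrow> (\<And>j. j \<notin> {1..r} \<Longrightarrow> h' j = k' j) \<Longrightarrow> f h = c * g h'"
  shows "nested_sum r M f k = c * nested_sum r M g k'"
  using assms
proof (induction r arbitrary: M k k')
  case 0
  then show ?case by simp
next
  case (Suc r)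
  have "nested_sum r (M - v) f (k(Suc r := v)) = c * nested_sum r (M - v) g (k'(Suc r := v))" for v
  proof (rule Suc.IH)
    fix h h' :: "nat \<Rightarrow> nat"
    assume 1: "\<And>j. j \<in> {1..r} \<Longrightarrow> h j = h' j"
      and 2: "\<And>j. j \<notin> {1..r} \<Longrightarrow> h j = (k(Suc r := v)) j"
      and 3: "\<And>j. j \<notin> {1..r} \<Longrightarrow> h' j = (k'(Suc r := v)) j"
    show "f h = c * g h'"
    proof (rule Suc.prems)
      fix j
      show "h j = h' j" if "j \<in> {1..Suc r}"
        using that 1[of j] 2[of j] 3[of j] by (cases "j = Suc r") auto
      show "h j = k j" if "j \<notin> {1..Suc r}" using that 2[of j] by auto
      show "h' j = k' j" if "j \<notin> {1..Suc r}" using that 3[of j] by auto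
    qed
  qed
  then show ?case by (simp add: sum_distrib_left)
qed

lemma falling_fact_Suc_left: "falling_fact y (Suc n) = y * falling_fact (y - 1) n"
  by (simp add: falling_fact_def prod.lessThan_Suc_shift diff_diff_eq del: prod.lessThan_Suc)

lemma falling_fact_of_nat_Suc:
  "falling_fact (of_nat (p + Suc l)) (Suc l) =
     (of_nat (Suc p) * falling_fact (of_nat (Suc p + l)) l :: 'a::comm_ring_1)"
  by (simp add: falling_fact_def algebra_simps)

lemma a_num_1: "a_num 1 N = of_nat (odd_dfact (N - 1))"
  by (simp add: a_num_def)

text \<open>Fixing the outermost variable at \<open>v\<close> frees one factor of the product, the
  one with \<open>j = Suc i\<close>, and one power \<open>2 ^ v\<close>. What remains is the summand
  of \<open>a_num i\<close> with \<open>N\<close> lowered by \<open>v + 1\<close>.\<close>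

lemma a_num_unroll:
  assumes "1 \<le> i" and "i < N"
  shows "a_num (Suc i) N = (\<Sum>v=0..N - Suc i. 2 ^ v *
    falling_fact (of_nat N - 1 - of_nat (Suc i) / 2) v * (a_num i (N - Suc v) :: 'a::field_char_0))"
proof -
  define f :: "nat \<Rightarrow> nat \<Rightarrow> (nat \<Rightarrow> nat) \<Rightarrow> 'a" where
    "f i N k = 2 ^ (\<Sum>j=1..i-1. k j) *
             (\<Prod>j=2..i. falling_fact
                (of_nat N - of_nat (\<Sum>l=j..i-1. k l) - (2 * of_nat i + 2 - of_nat j) / 2)
                (k (j - 1))) *
             of_nat (odd_dfact (N - i - (\<Sum>j=1..i-1. k j)))" for i N k
  \<comment> \<open>For \<open>i = 1\<close> there are no summation variables and
    \<open>f 1 N\<close> is just the double factorial, so the case split in \<open>a_num\<close>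
    disappears.\<close>
  have a: "a_num i N = nested_sum (i - 1) (N - i) (f i N) (\<lambda>_. 0)" if "1 \<le> i" for i N
  proof (cases "i = 1")
    case True
    then show ?thesis by (simp add: a_num_def f_def)
  next
    case False
    then show ?thesis unfolding a_num_def f_def by (simp only: if_False)
  qed
  obtain r where i: "i = Suc r" using assms by (cases i) auto
  have "nested_sum r (N - Suc i - v) (f (Suc i) N) ((\<lambda>_. 0)(Suc r := v)) =
      2 ^ v * falling_fact (of_nat N - 1 - of_nat (Suc i) / 2) v *
      nested_sum r (N - Suc i - v) (f i (N - Suc v)) (\<lambda>_. 0)" if v: "v \<le> N - Suc i" for v
  proof (rule nested_sum_scale)
    fix h h' :: "nat \<Rightarrow> nat"
    assume 1: "\<And>j. j \<in> {1..r} \<Longrightarrow> h j = h' j"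
      and 2: "\<And>j. j \<notin> {1..r} \<Longrightarrow> h j = ((\<lambda>_. 0)(Suc r := v)) j"
    have hv: "h (Suc r) = v" using 2[of "Suc r"] by simp
    have s: "(\<Sum>l=j..Suc r. h l) = (\<Sum>l=j..r. h' l) + v" if "1 \<le> j" "j \<le> Suc r" for j
    proof -
      have "(\<Sum>l=j..r. h l) = (\<Sum>l=j..r. h' l)" using that by (intro sum.cong) (auto intro: 1)
      then show ?thesis using that hv by (simp add: sum.atLeast_Suc_atMost)
    qed
    have N: "of_nat (N - Suc v) = (of_nat N - 1 - of_nat v :: 'a)"
      using v assms by (simp add: of_nat_diff)
    \<comment> \<open>Lowering \<open>N\<close> by \<open>v + 1\<close> accounts both for the share
      \<open>v\<close> of the inner sums and for the growth by 1 of
      \<open>(2 * i + 2 - j) / 2\<close> when \<open>i\<close> grows by 1.\<close>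
    have p: "(\<Prod>j=2..Suc r. falling_fact
                (of_nat N - of_nat (\<Sum>l=j..Suc r. h l) - (2 * of_nat (Suc (Suc r)) + 2 - of_nat j) / 2)
                (h (j - 1))) =
          (\<Prod>j=2..Suc r. falling_fact
                (of_nat (N - Suc v) - of_nat (\<Sum>l=j..r. h' l) - (2 * of_nat (Suc r) + 2 - of_nat j) / 2)
                (h' (j - 1)) :: 'a)"
    proof (rule prod.cong)
      fix j assume j: "j \<in> {2..Suc r}"
      have "h (j - 1) = h' (j - 1)" using j by (intro 1) auto
      then show "falling_fact
                (of_nat N - of_nat (\<Sum>l=j..Suc r. h l) - (2 * of_nat (Suc (Suc r)) + 2 - of_nat j) / 2)
                (h (j - 1)) = (falling_fact
                (of_nat (N - Suc v) - of_nat (\<Sum>l=j..r. h' l) - (2 * of_nat (Suc r) + 2 - of_nat j) / 2)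
                (h' (j - 1)) :: 'a)"
        using j by (subst s) (auto simp: N field_simps)
    qed simp
    \<comment> \<open>The argument of the freed factor, whose inner sum is empty.\<close>
    have q: "(of_nat N - (2 * of_nat (Suc (Suc r)) + 2 - of_nat (Suc (Suc r))) / 2 :: 'a) =
        of_nat N - 1 - of_nat (Suc i) / 2"
      by (simp add: i field_simps)
    have e: "odd_dfact (N - Suc (Suc r) - ((\<Sum>l=1..r. h' l) + v)) =
        odd_dfact (N - Suc v - Suc r - (\<Sum>l=1..r. h' l))"
      by (rule arg_cong[where f = odd_dfact]) simp
    have t: "(\<Prod>j=2..Suc (Suc r). g j) = (\<Prod>j=2..Suc r. g j) * (g (Suc (Suc r)) :: 'a)" for g
      by simp
    have s1: "(\<Sum>l=1..Suc r. h l) = (\<Sum>l=1..r. h' l) + v" by (rule s) auto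
    have s2: "(\<Sum>l=Suc (Suc r)..Suc r. h l) = 0" by simp
    show "f (Suc i) N h = 2 ^ v * falling_fact (of_nat N - 1 - of_nat (Suc i) / 2) v * f i (N - Suc v) h'"
      unfolding f_def q[symmetric]
      unfolding i t diff_Suc_1 p s1 s2 e hv of_nat_0 diff_0_right power_add by (simp only: mult_ac)
  qed
  moreover have "a_num (Suc i) N =
      (\<Sum>v=0..N - Suc i. nested_sum r (N - Suc i - v) (f (Suc i) N) ((\<lambda>_. 0)(Suc r := v)))"
    by (subst a) (simp_all add: i)
  moreover have "a_num i (N - Suc v) = nested_sum r (N - Suc i - v) (f i (N - Suc v)) (\<lambda>_. 0)" for v
  proof -
    have "i - 1 = r" "N - Suc v - i = N - Suc i - v" using i by auto
    then show ?thesis using a[OF assms(1), of "N - Suc v"] by simp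
  qed
  ultimately show ?thesis by (auto intro!: sum.cong)
qed

text \<open>Unroll at \<open>Suc N\<close>. The term \<open>v = 0\<close> is
  \<open>a_num i N\<close>; in the others,
  \<open>falling_fact y (Suc v) = y * falling_fact (y - 1) v\<close> with
  \<open>y = N - (i + 1) / 2\<close> splits off the factor \<open>2 * y\<close>, and unrolling at
  \<open>N\<close> identifies the rest.\<close>

lemma a_num_rec:
  assumes "1 \<le> i" and "i < N"
  shows "a_num (Suc i) (Suc N) =
    (of_nat (2 * N - Suc i) * a_num (Suc i) N + a_num i N :: 'a::field_char_0)"
proof -
  have "a_num (Suc i) (Suc N) = (\<Sum>v=0..Suc (N - Suc i). 2 ^ v *
      falling_fact (of_nat N - of_nat (Suc i) / 2) v * (a_num i (N - v) :: 'a))"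
    using assms by (subst a_num_unroll) (simp_all add: Suc_diff_Suc)
  also have "\<dots> = a_num i N + (\<Sum>v=0..N - Suc i. 2 ^ Suc v *
      falling_fact (of_nat N - of_nat (Suc i) / 2) (Suc v) * a_num i (N - Suc v))"
    by (subst sum.atLeast0_atMost_Suc_shift) (simp add: falling_fact_def del: power_Suc)
  also have "(\<Sum>v=0..N - Suc i. 2 ^ Suc v *
      falling_fact (of_nat N - of_nat (Suc i) / 2) (Suc v) * a_num i (N - Suc v)) =
      (2 * of_nat N - of_nat (Suc i) :: 'a) * a_num (Suc i) N"
    unfolding a_num_unroll[OF assms] sum_distrib_left
  proof (rule sum.cong)
    fix v
    let ?y = "of_nat N - of_nat (Suc i) / 2 :: 'a"
    have "2 ^ Suc v * falling_fact ?y (Suc v) * a_num i (N - Suc v) =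
        (2 * ?y) * (2 ^ v * falling_fact (?y - 1) v * a_num i (N - Suc v))"
      by (simp only: falling_fact_Suc_left power_Suc mult_ac)
    also have "2 * ?y = 2 * of_nat N - of_nat (Suc i)"
      by (simp add: field_simps)
    also have "?y - 1 = of_nat N - 1 - of_nat (Suc i) / 2"
      by simp
    finally show "2 ^ Suc v * falling_fact ?y (Suc v) * a_num i (N - Suc v) =
        (2 * of_nat N - of_nat (Suc i)) *
        (2 ^ v * falling_fact (of_nat N - 1 - of_nat (Suc i) / 2) v * a_num i (N - Suc v))" .
  qed simp
  finally show ?thesis using assms by (simp add: of_nat_diff)
qed

text \<open>Together with \<open>a_num_diag_rec\<close> this covers the two edges of the triangle,
  where one term of the recurrence is missing.\<close>

lemma a_num_1_rec:
  assumes "1 \<le> N"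
  shows "a_num 1 (Suc N) = (of_nat (2 * N - 1) * a_num 1 N :: 'a::field_char_0)"
  unfolding a_num_1 using assms by (cases N) (simp_all add: odd_dfact_def algebra_simps)

lemma a_num_diag_rec:
  assumes "1 \<le> N"
  shows "a_num (Suc N) (Suc N) = (a_num N N :: 'a::field_char_0)"
  using assms by (subst a_num_unroll) (simp_all add: falling_fact_def)

text \<open>Moves the recurrence from the coefficients to the weights \<open>f\<close>. The
  right-hand side has the shape that the product rule produces.\<close>

lemma sum_a_num_Suc:
  fixes f :: "nat \<Rightarrow> 'a::field_char_0"
  assumes "1 \<le> N"
  shows "(\<Sum>i=1..Suc N. a_num i (Suc N) * f i) =
    (\<Sum>i=1..N. a_num i N * (of_nat (2 * N - i) * f i + f (Suc i)))"
proof -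
  obtain M where N: "N = Suc M" using assms by (cases N) auto
  have split: "(\<Sum>i=1..Suc k. g i) = (g 1 + (\<Sum>i=1..k. g (Suc i)) :: 'a)" for g k
    by (simp add: sum.atLeast_Suc_atMost sum.shift_bounds_cl_Suc_ivl del: sum.cl_ivl_Suc)
  \<comment> \<open>The first and last terms are set apart because they obey the edge
    recurrences.\<close>
  have "(\<Sum>i=1..Suc N. a_num i (Suc N) * f i) =
      a_num 1 (Suc N) * f 1 + (\<Sum>i=1..M. a_num (Suc i) (Suc N) * f (Suc i))
      + a_num (Suc N) (Suc N) * f (Suc N)"
    by (subst split) (simp add: N)
  also have "(\<Sum>i=1..M. a_num (Suc i) (Suc N) * f (Suc i)) =
      (\<Sum>i=1..M. a_num (Suc i) N * (of_nat (2 * N - Suc i) * f (Suc i))) +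
      (\<Sum>i=1..M. a_num i N * f (Suc i))"
    unfolding sum.distrib[symmetric]
    by (rule sum.cong) (simp_all add: a_num_rec N algebra_simps)
  also have "a_num 1 (Suc N) * f 1 + (\<dots>) + a_num (Suc N) (Suc N) * f (Suc N) =
      (\<Sum>i=1..N. a_num i N * (of_nat (2 * N - i) * f i)) + (\<Sum>i=1..N. a_num i N * f (Suc i))"
    unfolding N split[of "\<lambda>i. a_num i (Suc M) * (of_nat (2 * Suc M - i) * f i)"]
    using a_num_1_rec[OF assms, where 'a = 'a] a_num_diag_rec[OF assms, where 'a = 'a]
    by (simp add: N mult_ac)
  finally show ?thesis by (simp only: distrib_left sum.distrib)
qed

section \<open>Coefficients and derivatives of formal power series\<close>

text \<open>The negative binomial series. By Pascal's rule, multiplying the candidate series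
  \<open>A (Suc k)\<close> by \<open>fps_const x - fps_X\<close> gives \<open>A k\<close>, and
  \<open>A 0\<close> is a geometric series.\<close>

lemma fps_nth_inverse_linear_power:
  fixes x :: "'a::field"
  assumes "x \<noteq> 0"
  shows "fps_nth (inverse (fps_const x - fps_X) ^ Suc k) m =
    of_nat ((k + m) choose m) * inverse x ^ (Suc k + m)"
proof -
  let ?c = "fps_const x - fps_X"
  define A where "A k = Abs_fps (\<lambda>m. of_nat ((k + m) choose m) * inverse x ^ (Suc k + m))" for k
  have c: "?c * inverse ?c = 1" by (rule inverse_mult_eq_1') (use assms in simp)
  have x: "x * (inverse x * z) = z" for z using assms by (simp flip: mult.assoc)
  have x1: "x * inverse x = 1" using assms by simp
  have A0: "A 0 * ?c = 1"
  proof (rule fps_ext)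
    fix m show "fps_nth (A 0 * ?c) m = fps_nth 1 m"
      by (cases m) (simp_all add: A_def algebra_simps x x1)
  qed
  have S: "A (Suc k) * ?c = A k" for k
  proof (rule fps_ext)
    fix m show "fps_nth (A (Suc k) * ?c) m = fps_nth (A k) m"
      by (cases m) (simp_all add: A_def algebra_simps x x1)
  qed
  have "inverse ?c ^ Suc k = A k"
  proof (induction k)
    case 0
    have "A 0 = A 0 * (?c * inverse ?c)" by (simp only: c mult_1_right)
    also have "\<dots> = inverse ?c" unfolding mult.assoc[symmetric] A0 by simp
    finally show ?case by (simp only: power_Suc power_0 mult_1_right)
  next
    case (Suc k)
    have "A (Suc k) = A (Suc k) * (?c * inverse ?c)" by (simp only: c mult_1_right)
    also have "\<dots> = A k * inverse ?c" unfolding mult.assoc[symmetric] S ..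
    finally show ?case using Suc by (simp add: mult_ac)
  qed
  then show ?thesis by (simp add: A_def)
qed

lemma fps_nth_inverse_one_minus_X_power:
  "fps_nth (inverse (1 - fps_X :: 'a::field fps) ^ Suc k) m = of_nat ((k + m) choose m)"
  using fps_nth_inverse_linear_power[of "1::'a" k m] by simp

lemma fps_nth_funpow_deriv:
  "fps_nth ((fps_deriv ^^ l) f) p =
     falling_fact (of_nat (p + l)) l * fps_nth (f :: 'a::comm_ring_1 fps) (p + l)"
proof (induction l arbitrary: p)
  case 0
  then show ?case by (simp add: falling_fact_def)
next
  case (Suc l)
  have "fps_nth ((fps_deriv ^^ Suc l) f) p = of_nat (Suc p) * fps_nth ((fps_deriv ^^ l) f) (Suc p)"
    by simp
  then show ?case
    unfolding Suc.IH falling_fact_of_nat_Suc by (simp add: mult_ac)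
qed

text \<open>The iterated Cauchy product, grouped by \<open>i = m + s\<close>, is reindexed by
  triples to match the innermost sum of the final identity.\<close>

lemma fps_mult3_nth:
  "fps_nth (f * g * h) n = (\<Sum>(m, s, p) \<in> {(m, s, p). m + s + p = n}.
     fps_nth f m * fps_nth g s * fps_nth (h :: 'a::comm_semiring_1 fps) p)"
proof -
  have "fps_nth (f * g * h) n =
      (\<Sum>i=0..n. \<Sum>m=0..i. fps_nth f m * fps_nth g (i - m) * fps_nth h (n - i))"
    by (simp add: fps_mult_nth sum_distrib_right)
  also have "\<dots> = (\<Sum>(i, m)\<in>(SIGMA i:{0..n}. {0..i}).
      fps_nth f m * fps_nth g (i - m) * fps_nth h (n - i))"
    by (subst sum.Sigma) auto
  also have "\<dots> = (\<Sum>(m, s, p) \<in> {(m, s, p). m + s + p = n}.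
     fps_nth f m * fps_nth g s * fps_nth h p)"
    by (rule sum.reindex_bij_witness[where i = "\<lambda>(m, s, p). (m + s, m)"
          and j = "\<lambda>(i, m). (m, i - m, n - i)"]) auto
  finally show ?thesis .
qed

text \<open>Leibniz' rule has only two terms here, because the second derivative of
  \<open>1 - fps_X\<close> vanishes.\<close>

lemma funpow_fps_deriv_one_minus_X_mult:
  "(fps_deriv ^^ Suc i) ((1 - fps_X) * g) =
     (1 - fps_X) * (fps_deriv ^^ Suc i) g - of_nat (Suc i) * (fps_deriv ^^ i) (g :: 'a::comm_ring_1 fps)"
proof (induction i)
  case 0
  then show ?case by (simp add: algebra_simps)
next
  case (Suc i)
  have "(fps_deriv ^^ Suc (Suc i)) ((1 - fps_X) * g) = fps_deriv ((fps_deriv ^^ Suc i) ((1 - fps_X) * g))"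
    by simp
  also have "\<dots> = (1 - fps_X) * (fps_deriv ^^ Suc (Suc i)) g -
      of_nat (Suc (Suc i)) * (fps_deriv ^^ Suc i) g"
    unfolding Suc by (simp add: algebra_simps)
  finally show ?case .
qed

text \<open>Leibniz' rule for \<open>F / (1 - t)\<close>, with \<open>F\<close> written as
  \<open>(1 - fps_X) * g\<close>: the derivative of order \<open>i - l\<close> of
  \<open>1 / (1 - t)\<close> carries \<open>fact (i - l)\<close>, and its product with the binomial
  coefficient is \<open>fact i / fact l\<close>.\<close>

lemma funpow_fps_deriv_divide_one_minus_X:
  fixes g :: "'a::field_char_0 fps"
  shows "(fps_deriv ^^ i) g = (\<Sum>l=0..i. fps_const (fact i / fact l) *
    inverse (1 - fps_X) ^ Suc (i - l) * (fps_deriv ^^ l) ((1 - fps_X) * g))"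
proof (induction i)
  let ?u = "1 - fps_X :: 'a fps"
  have u: "inverse ?u * (?u * h) = h" for h
    by (simp add: inverse_mult_eq_1 flip: mult.assoc)
  {
    case 0
    then show ?case by (simp add: u)
  next
    case (Suc i)
    let ?F = "\<lambda>l. (fps_deriv ^^ l) (?u * g)"
    have "(\<Sum>l=0..i. fps_const (fact (Suc i) / fact l) * inverse ?u ^ Suc (Suc i - l) * ?F l) =
        inverse ?u * (of_nat (Suc i) * (\<Sum>l=0..i. fps_const (fact i / fact l) *
          inverse ?u ^ Suc (i - l) * ?F l))"
      unfolding sum_distrib_left
    proof (rule sum.cong)
      fix l assume "l \<in> {0..i}"
      then have "Suc (Suc i - l) = Suc (Suc (i - l))" by auto
      moreover have "fps_const (fact (Suc i) / fact l) = of_nat (Suc i) * fps_const (fact i / fact l :: 'a)"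
        by (simp add: fps_of_nat[symmetric] del: of_nat_Suc)
      ultimately show "fps_const (fact (Suc i) / fact l) * inverse ?u ^ Suc (Suc i - l) * ?F l =
          inverse ?u * (of_nat (Suc i) * (fps_const (fact i / fact l) * inverse ?u ^ Suc (i - l) * ?F l))"
        by (simp only: power_Suc mult_ac)
    qed simp
    also have "\<dots> = inverse ?u * (of_nat (Suc i) * (fps_deriv ^^ i) g)"
      by (simp only: Suc)
    \<comment> \<open>The two-term rule, solved for the highest derivative of \<open>g\<close>; the
      added summand is the new term \<open>l = Suc i\<close>.\<close>
    also have "\<dots> + inverse ?u * ?F (Suc i) = inverse ?u * (?u * (fps_deriv ^^ Suc i) g)"
      unfolding funpow_fps_deriv_one_minus_X_mult by (simp only: ring_distribs) simp
    finally have "(\<Sum>l=0..i. fps_const (fact (Suc i) / fact l) * inverse ?u ^ Suc (Suc i - l) * ?F l) +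
        inverse ?u * ?F (Suc i) = (fps_deriv ^^ Suc i) g"
      by (simp only: u)
    moreover have "fps_const (fact (Suc i) / fact (Suc i)) * inverse ?u ^ Suc (Suc i - Suc i) = inverse ?u"
      by (simp del: fact_Suc)
    ultimately show ?case by (simp only: sum.atLeast0_atMost_Suc)
  }
qed

section \<open>Powers of the reciprocal quadratic through its derivatives\<close>

context
  fixes x :: "'a::field_char_0"
begin

text \<open>The series \<open>G\<close>, which generates the Chebyshev polynomials of the second
  kind.\<close>

definition cheb_inv :: "'a fps" where
  "cheb_inv = inverse (1 - fps_const (2 * x) * fps_X + fps_X ^ 2)"

lemma cheb3_gf_eq: "cheb3_gf x = (1 - fps_X) * cheb_inv"
  unfolding cheb3_gf_def cheb_inv_def by (rule fps_divide_unit) simp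

lemma cheb_inv_deriv: "fps_deriv cheb_inv = 2 * (fps_const x - fps_X) * cheb_inv ^ 2"
proof -
  have "fps_deriv (1 - fps_const (2 * x) * fps_X + fps_X ^ 2) = - 2 * (fps_const x - fps_X)"
    by (simp add: fps_deriv_power algebra_simps numeral_fps_const)
  then show ?thesis
    unfolding cheb_inv_def by (subst fps_inverse_deriv) simp_all
qed

text \<open>Induction step: differentiate and divide by \<open>x - t\<close>. On the left this
  raises the power of \<open>G\<close> and contributes \<open>2 * (N + 1)\<close>; on the right the
  product rule yields the weights of \<open>sum_a_num_Suc\<close>. A nonzero \<open>x\<close> makes
  \<open>x - t\<close> invertible.\<close>

lemma cheb_inv_power_eq_sum_derivs:
  assumes x: "x \<noteq> 0" and "1 \<le> N"
  shows "of_nat (2 ^ N * fact N) * cheb_inv ^ Suc N =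
    (\<Sum>i=1..N. fps_const (a_num i N) * (inverse (fps_const x - fps_X) ^ (2 * N - i) *
      (fps_deriv ^^ i) cheb_inv))"
  using \<open>1 \<le> N\<close>
proof (induction N rule: nat_induct_at_least)
  let ?c = "fps_const x - fps_X"
  let ?d = "inverse ?c"
  have c: "?d * ?c = 1" by (rule inverse_mult_eq_1) (use x in simp)
  {
    case base
    show ?case
    proof -
      have "?d * (2 * ?c * cheb_inv ^ 2) = (?d * ?c) * (2 * cheb_inv ^ 2)"
        by (simp only: mult_ac)
      then show ?thesis
        unfolding c by (simp add: a_num_1[simplified] odd_dfact_def cheb_inv_deriv power2_eq_square)
    qed
  next
    case (Suc N)
    let ?T = "\<lambda>i. ?d ^ (2 * Suc N - i) * (fps_deriv ^^ i) cheb_inv"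
    have d: "fps_deriv (?d ^ k) = of_nat k * ?d ^ Suc k" for k
    proof -
      have "fps_deriv ?d = ?d ^ 2"
        using x by (subst fps_inverse_deriv) simp_all
      then show ?thesis by (induction k) (simp_all add: algebra_simps power2_eq_square)
    qed
    have summand: "?d * fps_deriv (?d ^ (2 * N - i) * (fps_deriv ^^ i) cheb_inv) =
        of_nat (2 * N - i) * ?T i + ?T (Suc i)" if "i \<in> {1..N}" for i
    proof -
      \<comment> \<open>One extra power of \<open>?d\<close> comes from the outer factor; when the
        power of \<open>?d\<close> is differentiated, a second one appears.\<close>
      have "2 * Suc N - i = Suc (Suc (2 * N - i))" "2 * Suc N - Suc i = Suc (2 * N - i)"
        using that by auto
      then show ?thesis by (simp add: d algebra_simps)
    qed
    have "of_nat (2 ^ Suc N * fact (Suc N)) * cheb_inv ^ Suc (Suc N) =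
        (?d * ?c) * (of_nat (2 ^ Suc N * fact (Suc N)) * cheb_inv ^ Suc (Suc N))"
      by (simp only: c mult_1)
    also have "\<dots> = ?d * fps_deriv (of_nat (2 ^ N * fact N) * cheb_inv ^ Suc N)"
    proof -
      have "2 ^ Suc N * fact (Suc N) = 2 * Suc N * (2 ^ N * fact N :: nat)"
        by (simp only: power_Suc fact_Suc of_nat_id mult_ac)
      then have K: "of_nat (2 ^ Suc N * fact (Suc N)) =
          2 * of_nat (Suc N) * (of_nat (2 ^ N * fact N) :: 'a fps)"
        by (simp only: of_nat_mult of_nat_numeral)
      have "fps_deriv (of_nat (2 ^ N * fact N) * cheb_inv ^ Suc N) =
          of_nat (2 ^ N * fact N) * fps_deriv (cheb_inv ^ Suc N)"
        by (simp only: fps_of_nat[symmetric] fps_deriv_mult_const_left)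
      also have "fps_deriv (cheb_inv ^ Suc N) = of_nat (Suc N) * fps_deriv cheb_inv * cheb_inv ^ N"
        by (simp only: fps_deriv_power diff_Suc_1 fps_of_nat)
      finally show ?thesis
        unfolding K cheb_inv_deriv by (simp only: power2_eq_square power_Suc mult_ac)
    qed
    also have "\<dots> = (\<Sum>i=1..N. fps_const (a_num i N) * (of_nat (2 * N - i) * ?T i + ?T (Suc i)))"
      unfolding Suc.IH fps_deriv_sum sum_distrib_left
    proof (rule sum.cong)
      fix i assume i: "i \<in> {1..N}"
      show "?d * fps_deriv (fps_const (a_num i N) *
          (?d ^ (2 * N - i) * (fps_deriv ^^ i) cheb_inv)) =
          fps_const (a_num i N) * (of_nat (2 * N - i) * ?T i + ?T (Suc i))"
        unfolding fps_deriv_mult_const_left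
        unfolding mult.left_commute[of ?d "fps_const (a_num i N)"]
        unfolding summand[OF i] ..
    qed simp
    also have "\<dots> = (\<Sum>i=1..Suc N. fps_const (a_num i (Suc N)) * ?T i)"
    \<comment> \<open>\<open>sum_a_num_Suc\<close> is stated over a field, so it is applied to each
      coefficient.\<close>
    proof (rule fps_ext)
      fix k
      show "fps_nth (\<Sum>i=1..N. fps_const (a_num i N) * (of_nat (2 * N - i) * ?T i + ?T (Suc i))) k =
          fps_nth (\<Sum>i=1..Suc N. fps_const (a_num i (Suc N)) * ?T i) k"
        unfolding fps_sum_nth fps_mult_left_const_nth fps_add_nth fps_of_nat[symmetric]
        unfolding sum_a_num_Suc[OF Suc.hyps] ..
    qed
    finally show ?case .
  }
qed

section \<open>Comparison of coefficients\<close>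

text \<open>The argument works for any nonzero \<open>x\<close> in a field of characteristic 0; the
  indeterminate of the rational functions is one instance.\<close>

lemma cheb3_identity:
  assumes x: "x \<noteq> 0" and N: "1 \<le> N"
  shows "(\<Sum>l=0..n. of_nat ((N + n - l) choose (n - l)) * cheb3_ho (of_nat (N + 1)) l x) =
    1 / (2 ^ N * fact N) *
    (\<Sum>i=1..N. \<Sum>l=0..i. a_num i N * (fact i / fact l) *
      (\<Sum>(m, s, p) \<in> {(m, s, p). m + s + p = n}.
         of_nat ((2 * N + m - i - 1) choose m) * of_nat ((i - l + s) choose s) *
         falling_fact (of_nat (p + l)) l *
         x powi (int i - 2 * int N - int m) * cheb3 (p + l) x))"
proof -
  let ?c = "fps_const x - fps_X"
  let ?u = "1 - fps_X :: 'a fps"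
  have u: "?u * inverse ?u = 1" by (rule inverse_mult_eq_1') simp
  \<comment> \<open>The binomial weights are the coefficients of \<open>(1 - t)\<close> to the power
    \<open>-(N + 1)\<close>, so the sum is a Cauchy product.\<close>
  have "(\<Sum>l=0..n. of_nat ((N + n - l) choose (n - l)) * cheb3_ho (of_nat (N + 1)) l x) =
      fps_nth (cheb3_gf x ^ Suc N * inverse ?u ^ Suc N) n"
    unfolding cheb3_ho_of_nat fps_mult_nth fps_nth_inverse_one_minus_X_power
    by (intro sum.cong) (simp_all add: mult_ac)
  also have "cheb3_gf x ^ Suc N * inverse ?u ^ Suc N = cheb_inv ^ Suc N"
  proof -
    have "(?u * cheb_inv) * inverse ?u = (?u * inverse ?u) * cheb_inv"
      by (simp only: mult_ac)
    then have "(?u * cheb_inv) * inverse ?u = cheb_inv" by (simp only: u mult_1)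
    then show ?thesis
      by (simp only: cheb3_gf_eq power_mult_distrib[symmetric])
  qed
  finally have lhs: "(\<Sum>l=0..n. of_nat ((N + n - l) choose (n - l)) * cheb3_ho (of_nat (N + 1)) l x) =
      fps_nth (cheb_inv ^ Suc N) n" .
  have summand: "fps_nth (inverse ?c ^ (2 * N - i) * inverse ?u ^ Suc (i - l) *
        (fps_deriv ^^ l) (cheb3_gf x)) n =
      (\<Sum>(m, s, p) \<in> {(m, s, p). m + s + p = n}.
         of_nat ((2 * N + m - i - 1) choose m) * of_nat ((i - l + s) choose s) *
         falling_fact (of_nat (p + l)) l *
         x powi (int i - 2 * int N - int m) * cheb3 (p + l) x)" if i: "i \<in> {1..N}" for i l
  proof -
    \<comment> \<open>The exponent is positive because \<open>i\<close> is at most \<open>N\<close>,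
      so the negative binomial formula, stated for successors, applies.\<close>
    obtain k where k: "2 * N - i = Suc k" using i by (cases "2 * N - i") auto
    have "2 * N + m - i - 1 = k + m" for m using k i by auto
    moreover have "x powi (int i - 2 * int N - int m) = inverse x ^ (Suc k + m)" for m
    proof -
      have "int i - 2 * int N - int m = - int (Suc k + m)" using k i by linarith
      then show ?thesis by (simp only: power_int_minus power_int_of_nat power_inverse)
    qed
    ultimately show ?thesis
      unfolding fps_mult3_nth k fps_nth_inverse_linear_power[OF x]
        fps_nth_inverse_one_minus_X_power fps_nth_funpow_deriv cheb3_def
      by (intro sum.cong) (auto simp: mult_ac)
  qed
  have "of_nat (2 ^ N * fact N) * fps_nth (cheb_inv ^ Suc N) n =
      fps_nth (of_nat (2 ^ N * fact N) * cheb_inv ^ Suc N) n"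
    by (simp only: fps_of_nat[symmetric] fps_mult_left_const_nth)
  also have "\<dots> = (\<Sum>i=1..N. a_num i N * fps_nth (inverse ?c ^ (2 * N - i) * (fps_deriv ^^ i) cheb_inv) n)"
    unfolding cheb_inv_power_eq_sum_derivs[OF x N] by (simp only: fps_sum_nth fps_mult_left_const_nth)
  also have "\<dots> = (\<Sum>i=1..N. \<Sum>l=0..i. a_num i N * (fact i / fact l) *
      fps_nth (inverse ?c ^ (2 * N - i) * inverse ?u ^ Suc (i - l) * (fps_deriv ^^ l) (cheb3_gf x)) n)"
  proof (rule sum.cong)
    fix i
    \<comment> \<open>Leibniz' rule with \<open>g = cheb_inv\<close>, for which
      \<open>(1 - fps_X) * g\<close> is the generating function of the \<open>cheb3\<close>
      values.\<close>
    have "inverse ?c ^ (2 * N - i) * (fps_deriv ^^ i) cheb_inv =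
        (\<Sum>l=0..i. fps_const (fact i / fact l) * (inverse ?c ^ (2 * N - i) *
          inverse ?u ^ Suc (i - l) * (fps_deriv ^^ l) (cheb3_gf x)))"
      unfolding cheb3_gf_eq
      by (subst funpow_fps_deriv_divide_one_minus_X) (simp only: sum_distrib_left mult_ac)
    then show "a_num i N * fps_nth (inverse ?c ^ (2 * N - i) * (fps_deriv ^^ i) cheb_inv) n =
        (\<Sum>l=0..i. a_num i N * (fact i / fact l) *
      fps_nth (inverse ?c ^ (2 * N - i) * inverse ?u ^ Suc (i - l) * (fps_deriv ^^ l) (cheb3_gf x)) n)"
      by (simp only: fps_sum_nth fps_mult_left_const_nth sum_distrib_left mult.assoc)
  qed simp
  also have "\<dots> = (\<Sum>i=1..N. \<Sum>l=0..i. a_num i N * (fact i / fact l) *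
      (\<Sum>(m, s, p) \<in> {(m, s, p). m + s + p = n}.
         of_nat ((2 * N + m - i - 1) choose m) * of_nat ((i - l + s) choose s) *
         falling_fact (of_nat (p + l)) l *
         x powi (int i - 2 * int N - int m) * cheb3 (p + l) x))" (is "_ = ?R")
  proof (rule sum.cong[OF refl], rule sum.cong[OF refl])
    fix i l assume i: "i \<in> {1..N}"
    show "a_num i N * (fact i / fact l) * fps_nth (inverse ?c ^ (2 * N - i) *
          inverse ?u ^ Suc (i - l) * (fps_deriv ^^ l) (cheb3_gf x)) n =
        a_num i N * (fact i / fact l) * (\<Sum>(m, s, p) \<in> {(m, s, p). m + s + p = n}.
         of_nat ((2 * N + m - i - 1) choose m) * of_nat ((i - l + s) choose s) *
         falling_fact (of_nat (p + l)) l *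
         x powi (int i - 2 * int N - int m) * cheb3 (p + l) x)"
      unfolding summand[OF i] ..
  qed
  finally have R: "of_nat (2 ^ N * fact N) * fps_nth (cheb_inv ^ Suc N) n = ?R" .
  show ?thesis
    unfolding lhs R[symmetric] by simp
qed

end

lemma ratfun_x_nonzero: "ratfun_x \<noteq> 0"
  by (simp add: ratfun_x_def)

theorem theorem5:
  fixes N n :: nat and x :: "real poly fract"
  assumes "N \<ge> 1" and "x = ratfun_x"
  shows "(\<Sum>l=0..n. of_nat ((N + n - l) choose (n - l)) * cheb3_ho (of_nat (N + 1)) l x) =
    1 / (2 ^ N * fact N) *
    (\<Sum>i=1..N. \<Sum>l=0..i. a_num i N * (fact i / fact l) *
      (\<Sum>(m, s, p) \<in> {(m, s, p). m + s + p = n}.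
         of_nat ((2 * N + m - i - 1) choose m) * of_nat ((i - l + s) choose s) *
         falling_fact (of_nat (p + l)) l *
         x powi (int i - 2 * int N - int m) * cheb3 (p + l) x))"
  using cheb3_identity[OF _ assms(1)] ratfun_x_nonzero assms(2) by blast

end
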